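(* Let $Z:=\xi\eta$, where the random variable $\xi$ and the random vector $\eta=(\eta_i)_{i=1}^k$ are independent and $\xi$ is non-negative with regularly varying right tail with index $\alpha>0$. Let also $\tau:\mathbb R^k\to[0,\infty)$ be a non-negative continuous $1$-homogeneous function and suppose that $0<\mathbb E[\tau(\eta)^\alpha]<\infty$. If either (i) $t^\alpha\mathbb P[\xi>t]\to c_\xi$ as $t\to\infty$ for some $c_\xi\in(0,\infty)$; or (ii) $\mathbb E[\tau(\eta)^{\alpha+\delta}]<\infty$ for some $\delta>0$, then $$\frac{\mathbb P[\tau(Z)>t]}{\mathbb P[\xi>t]}\longrightarrow\mathbb E[\tau(\eta)^\alpha],\quad t\to\infty,$$ and $$\frac{Z}{\tau(Z)}\ \Big|\ \{\tau(Z)>t\}\ \stackrel{TV}{\longrightarrow}\ \Theta_Z,\quad t\to\infty,$$ where $\stackrel{TV}{\to}$ denotes convergence of the probability laws in total variation and $\Theta_Z$ has the probability distribution $\sigma$ on $S_\tau=\{x\in\mathbb R^k:\tau(x)=1\}$ such that $$\sigma(A)=\frac{1}{\mathbb E[\tau(\eta)^\alpha]}\,\mathbb E\big[1_A(\eta/\tau(\eta))\,\tau(\eta)^\alpha\big],\quad A\in\mathcal B(S_\tau).$$ In particular, $Z\in RV_\alpha(\mathbb R^k,\{a_n\},c_Z,\tau,\sigma)$, where $n\mathbb P[\xi>a_n]\sim1$ as $n\to\infty$ and $c_Z=\mathbb E[\tau(\eta)^\alpha]$.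
   Context: $\tau$ is $1$-homogeneous if $\tau(cx)=c\tau(x)$ for all $c\ge0$, $x\in\mathbb R^k$. A non-negative variable $\xi$ has regularly varying right tail with index $\alpha>0$ if $\mathbb P[\xi>tx]/\mathbb P[\xi>t]\to x^{-\alpha}$ as $t\to\infty$, for all $x>0$. The notation $Z\in RV_\alpha(\mathbb R^k,\{a_n\},c_Z,\tau,\sigma)$ means: for all $t>0$, $n\mathbb P[\tau(Z)>ta_n]\to c_Zt^{-\alpha}$ as $n\to\infty$, and the conditional law of $Z/\tau(Z)$ given $\tau(Z)>r$ converges weakly to $\sigma$ (a probability measure on $S_\tau$) as $r\to\infty$. The integrand $1_A(\eta/\tau(\eta))\tau(\eta)^\alpha$ is $0$ when $\tau(\eta)=0$. *)

theory Defs
  imports "HOL-Probability.Probability"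
begin

definition one_homogeneous :: "('b::real_vector \<Rightarrow> real) \<Rightarrow> bool" where
  "one_homogeneous \<tau> \<longleftrightarrow> (\<forall>c\<ge>0. \<forall>x. \<tau> (c *\<^sub>R x) = c * \<tau> x)"

(* If the tail vanishes from some point on, the quotient is eventually 0 (division by zero) and
   the limit condition fails; so the definition forces P[xi > t] > 0 for all t. *)
definition regularly_varying_tail :: "'a measure \<Rightarrow> ('a \<Rightarrow> real) \<Rightarrow> real \<Rightarrow> bool" where
  "regularly_varying_tail M \<xi> \<alpha> \<longleftrightarrow> (\<forall>x>0.
     ((\<lambda>t. measure M {\<omega>\<in>space M. \<xi> \<omega> > t * x} / measure M {\<omega>\<in>space M. \<xi> \<omega> > t})
        \<longlongrightarrow> x powr (- \<alpha>)) at_top)"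

(* The library's indep_var requires both variables to take values in the same type. *)
definition indep_rvs ::
  "'a measure \<Rightarrow> ('a \<Rightarrow> 'b::topological_space) \<Rightarrow> ('a \<Rightarrow> 'c::topological_space) \<Rightarrow> bool" where
  "indep_rvs M X Y \<longleftrightarrow> X \<in> borel_measurable M \<and> Y \<in> borel_measurable M \<and>
     prob_space.indep_set M {X -` A \<inter> space M |A. A \<in> sets borel}
                            {Y -` B \<inter> space M |B. B \<in> sets borel}"

definition level_sphere :: "('b \<Rightarrow> real) \<Rightarrow> 'b set" where
  "level_sphere \<tau> = {x. \<tau> x = 1}"

abbreviation sphere_borel :: "('b::topological_space \<Rightarrow> real) \<Rightarrow> 'b measure" where
  "sphere_borel \<tau> \<equiv> restrict_space borel (level_sphere \<tau>)"

(* The conditional law, given an event A, of an N-valued X. Restricting the probability space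
   to A matters: X need only map A, not all of space M, into space N. *)
definition cond_law :: "'a measure \<Rightarrow> 'a set \<Rightarrow> 'b measure \<Rightarrow> ('a \<Rightarrow> 'b) \<Rightarrow> 'b measure" where
  "cond_law M A N X = distr (uniform_measure (restrict_space M A) A) N X"

definition angular_law ::
  "'a measure \<Rightarrow> ('a \<Rightarrow> 'b::real_normed_vector) \<Rightarrow> ('b \<Rightarrow> real) \<Rightarrow> real \<Rightarrow> 'b measure" where
  "angular_law M Z \<tau> t =
     cond_law M {\<omega>\<in>space M. \<tau> (Z \<omega>) > t} (sphere_borel \<tau>) (\<lambda>\<omega>. Z \<omega> /\<^sub>R \<tau> (Z \<omega>))"

definition tv_dist :: "'b measure \<Rightarrow> 'b measure \<Rightarrow> real" where
  "tv_dist \<mu> \<nu> = (SUP A\<in>sets \<nu>. \<bar>measure \<mu> A - measure \<nu> A\<bar>)"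

(* The library's weak_conv_m covers only sequences of laws on the real line. *)
definition weakly_converges_on ::
  "'b::topological_space set \<Rightarrow> ('i \<Rightarrow> 'b measure) \<Rightarrow> 'b measure \<Rightarrow> 'i filter \<Rightarrow> bool" where
  "weakly_converges_on S \<mu> \<nu> F \<longleftrightarrow>
     (\<forall>f::'b \<Rightarrow> real. continuous_on S f \<and> bounded (f ` S) \<longrightarrow>
        ((\<lambda>i. \<integral>x. f x \<partial>\<mu> i) \<longlongrightarrow> (\<integral>x. f x \<partial>\<nu>)) F)"

definition RV ::
  "'a measure \<Rightarrow> ('a \<Rightarrow> 'b::real_normed_vector) \<Rightarrow> real \<Rightarrow> (nat \<Rightarrow> real) \<Rightarrow> real \<Rightarrow>
     ('b \<Rightarrow> real) \<Rightarrow> 'b measure \<Rightarrow> bool" where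
  "RV M Z \<alpha> a c \<tau> \<sigma> \<longleftrightarrow>
     Z \<in> borel_measurable M \<and>
     prob_space \<sigma> \<and> sets \<sigma> = sets (sphere_borel \<tau>) \<and>
     (\<forall>t>0. (\<lambda>n. real n * measure M {\<omega>\<in>space M. \<tau> (Z \<omega>) > t * a n})
               \<longlonglongrightarrow> c * t powr (- \<alpha>)) \<and>
     weakly_converges_on (level_sphere \<tau>) (angular_law M Z \<tau>) \<sigma> at_top"

end

theory Submission
  imports Defs
begin

text \<open>
  Write \<open>F t = P[\<xi> > t]\<close>. By independence and homogeneity, for \<open>t \<ge> 0\<close>, the joint probability of
  \<open>\<tau> Z > t\<close> and \<open>Z / \<tau> Z \<in> A\<close> is the expectation of \<open>1_A(\<eta> / \<tau> \<eta>) F (t / \<tau> \<eta>)\<close>.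
  Regular variation gives \<open>F (t / \<tau> \<eta>) / F t \<longlongrightarrow> \<tau> \<eta> powr \<alpha>\<close> pointwise; this ratio is dominated by a
  multiple of \<open>\<tau> \<eta> powr \<alpha>\<close> in case (i), and by a Potter bound \<open>1 + C * \<tau> \<eta> powr (\<alpha> + \<delta>)\<close> in
  case (ii). Hence the angular laws and \<open>\<sigma>\<close> are images under one and the same map of probability
  densities that converge in \<open>L\<^sup>1\<close>, which yields both total variation and weak convergence.
\<close>

section \<open>Independence and integration over sections\<close>

text \<open>Independence makes the joint law agree with the product of the marginals on rectangles,
  hence everywhere. The section formula for the product measure then integrates \<open>X\<close> out
  first, with \<open>Y\<close> frozen. Later \<open>X\<close> is \<open>\<xi>\<close> and
  \<open>Y\<close> is \<open>\<eta>\<close>, so that the inner probability is a tail of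
  \<open>\<xi>\<close>.\<close>

lemma indep_rvs_measure_Fubini:
  fixes X :: "'a \<Rightarrow> 'b::topological_space" and Y :: "'a \<Rightarrow> 'c::topological_space"
  assumes "prob_space M" and ind: "indep_rvs M X Y" and S: "S \<in> sets (borel \<Otimes>\<^sub>M borel)"
  shows "measure M {\<omega>\<in>space M. (X \<omega>, Y \<omega>) \<in> S} =
    (\<integral>\<omega>. measure M {\<omega>'\<in>space M. (X \<omega>', Y \<omega>) \<in> S} \<partial>M)"
proof -
  interpret prob_space M by fact
  have X [measurable]: "X \<in> borel_measurable M" and Y [measurable]: "Y \<in> borel_measurable M"
    and *: "indep_set {X -` A \<inter> space M |A. A \<in> sets borel} {Y -` B \<inter> space M |B. B \<in> sets borel}"
    using ind by (auto simp: indep_rvs_def)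
  let ?P = "distr M borel X" and ?Q = "distr M borel Y"
  interpret P: prob_space ?P by (rule prob_space_distr) simp
  interpret Q: prob_space ?Q by (rule prob_space_distr) simp
  interpret PQ: pair_prob_space ?P ?Q ..
  have joint: "?P \<Otimes>\<^sub>M ?Q = distr M (borel \<Otimes>\<^sub>M borel) (\<lambda>\<omega>. (X \<omega>, Y \<omega>))"
  proof (rule pair_measure_eqI)
    fix A B assume AB: "A \<in> sets ?P" "B \<in> sets ?Q"
    then have [measurable]: "A \<in> sets borel" "B \<in> sets borel" by auto
    have "prob ((X -` A \<inter> space M) \<inter> (Y -` B \<inter> space M)) =
      prob (X -` A \<inter> space M) * prob (Y -` B \<inter> space M)"
      using AB by (intro indep_setD[OF *]) auto
    moreover have "(\<lambda>\<omega>. (X \<omega>, Y \<omega>)) -` (A \<times> B) \<inter> space M =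
      (X -` A \<inter> space M) \<inter> (Y -` B \<inter> space M)" by auto
    ultimately show "emeasure ?P A * emeasure ?Q B =
      emeasure (distr M (borel \<Otimes>\<^sub>M borel) (\<lambda>\<omega>. (X \<omega>, Y \<omega>))) (A \<times> B)"
      by (simp add: emeasure_distr emeasure_eq_measure ennreal_mult')
  qed (auto intro: P.sigma_finite_measure_axioms Q.sigma_finite_measure_axioms)
  have S' [measurable]: "S \<in> sets (?P \<Otimes>\<^sub>M ?Q)"
    using S by simp
  have sec: "(\<lambda>x. (x, y)) -` S \<in> sets borel" for y
    using sets_Pair2[OF S] .
  have preim: "X -` ((\<lambda>x. (x, y)) -` S) \<inter> space M = {\<omega>'\<in>space M. (X \<omega>', y) \<in> S}" for y
    by auto
  have "(\<lambda>y. measure ?P ((\<lambda>x. (x, y)) -` S)) \<in> borel_measurable ?Q"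
    unfolding measure_def using PQ.measurable_emeasure_Pair2[OF S'] by measurable
  then have m: "(\<lambda>y. measure M {\<omega>'\<in>space M. (X \<omega>', y) \<in> S}) \<in> borel_measurable borel"
    using sec by (simp add: measure_distr preim)
  have [measurable]: "(\<lambda>\<omega>. measure M {\<omega>'\<in>space M. (X \<omega>', Y \<omega>) \<in> S}) \<in> borel_measurable M"
    by (rule measurable_compose[OF Y m])
  have "emeasure M {\<omega>\<in>space M. (X \<omega>, Y \<omega>) \<in> S} = emeasure (?P \<Otimes>\<^sub>M ?Q) S"
    using S unfolding joint
    by (subst emeasure_distr) (auto intro!: arg_cong[where f="emeasure M"])
  also have "\<dots> = (\<integral>\<^sup>+y. emeasure ?P ((\<lambda>x. (x, y)) -` S) \<partial>?Q)"
    by (rule PQ.emeasure_pair_measure_alt2[OF S'])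
  also have "\<dots> = (\<integral>\<^sup>+y. ennreal (measure M {\<omega>'\<in>space M. (X \<omega>', y) \<in> S}) \<partial>?Q)"
    using sec by (simp add: emeasure_distr emeasure_eq_measure preim)
  also have "\<dots> = (\<integral>\<^sup>+\<omega>. ennreal (measure M {\<omega>'\<in>space M. (X \<omega>', Y \<omega>) \<in> S}) \<partial>M)"
    using m by (subst nn_integral_distr) auto
  also have "\<dots> = ennreal (\<integral>\<omega>. measure M {\<omega>'\<in>space M. (X \<omega>', Y \<omega>) \<in> S} \<partial>M)"
    by (intro nn_integral_eq_integral integrable_const_bound[where B=1]) auto
  finally show ?thesis
    by (simp add: emeasure_eq_measure Bochner_Integration.integral_nonneg)
qed

section \<open>Bounds on tail ratios\<close>

text \<open>Since \<open>2 powr (- \<beta>)\<close> lies strictly below the limit of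
  \<open>F (t * 2) / F t\<close>, doubling the argument beyond some \<open>T\<close> costs at most a
  factor \<open>2 powr \<beta>\<close>. Iterating gives the bound for powers of two, and
  monotonicity extends it to every \<open>u \<ge> 1\<close>; rounding \<open>u\<close> up to a power
  of two accounts for the 2 in \<open>2 * u\<close>.\<close>

lemma Potter_lower_bound:
  fixes F :: "real \<Rightarrow> real"
  assumes "antimono F" and pos: "\<And>t. F t > 0" and "\<beta> > \<alpha>" and "\<beta> > 0"
    and lim: "((\<lambda>t. F (t * 2) / F t) \<longlongrightarrow> 2 powr (- \<alpha>)) at_top"
  obtains T where "T > 0" "\<And>t u. t \<ge> T \<Longrightarrow> u \<ge> 1 \<Longrightarrow> F t \<le> (2 * u) powr \<beta> * F (t * u)"
proof -
  have "(2::real) powr (- \<beta>) < 2 powr (- \<alpha>)"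
    using \<open>\<beta> > \<alpha>\<close> by simp
  from order_tendstoD(1)[OF lim this] obtain T0 where
    T0: "\<And>t. t \<ge> T0 \<Longrightarrow> 2 powr (- \<beta>) < F (t * 2) / F t"
    by (auto simp: eventually_at_top_linorder)
  \<comment> \<open>Positivity of \<open>T\<close> ensures that repeated doubling never leaves the
    range \<open>t \<ge> T\<close>.\<close>
  define T where "T = max T0 1"
  have step: "F t \<le> 2 powr \<beta> * F (t * 2)" if "t \<ge> T" for t
    using T0[of t] that pos[of t] by (simp add: T_def field_simps powr_minus)
  have iter: "F t \<le> 2 powr (\<beta> * real n) * F (t * 2 ^ n)" if t: "t \<ge> T" for t n
  proof (induction n)
    case (Suc n)
    have "t * 1 \<le> t * 2 ^ n"
      using t by (intro mult_left_mono) (auto simp: T_def)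
    then have "t * 2 ^ n \<ge> T" using t by simp
    from step[OF this] have "F (t * 2 ^ n) \<le> 2 powr \<beta> * F (t * 2 ^ Suc n)"
      by (simp add: mult_ac)
    then have *: "2 powr (\<beta> * real n) * F (t * 2 ^ n) \<le>
        2 powr (\<beta> * real n) * (2 powr \<beta> * F (t * 2 ^ Suc n))"
      by (intro mult_left_mono) auto
    from order.trans[OF Suc *] show ?case by (simp add: powr_add distrib_left mult_ac)
  qed simp
  show ?thesis
  proof
    show "T > 0" by (simp add: T_def)
    fix t u :: real assume t: "t \<ge> T" and u: "u \<ge> 1"
    \<comment> \<open>The least \<open>n\<close> with \<open>u \<le> 2 ^ n\<close>; minimality
      yields \<open>2 ^ n \<le> 2 * u\<close>.\<close>
    define n where "n = nat \<lceil>log 2 u\<rceil>"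
    have l0: "log 2 u \<ge> 0" using u by simp
    have n: "log 2 u \<le> real n" "real n \<le> log 2 u + 1"
      using l0 by (auto simp: n_def)
    have "u = 2 powr (log 2 u)" using u by simp
    also have "\<dots> \<le> 2 powr real n" using n by simp
    also have "\<dots> = 2 ^ n" by (simp add: powr_realpow)
    finally have un: "u \<le> 2 ^ n" .
    have "2 ^ n = 2 powr real n" by (simp add: powr_realpow)
    also have "\<dots> \<le> 2 powr (log 2 u + 1)" using n by simp
    also have "\<dots> = 2 * u" using u by (simp add: powr_add)
    finally have nu: "(2::real) ^ n \<le> 2 * u" .
    have "F t \<le> 2 powr (\<beta> * real n) * F (t * 2 ^ n)" by (rule iter[OF t])
    also have "2 powr (\<beta> * real n) = (2 ^ n) powr \<beta>"
      by (simp add: powr_powr powr_realpow[symmetric] mult.commute)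
    also have "(2 ^ n) powr \<beta> * F (t * 2 ^ n) \<le> (2 * u) powr \<beta> * F (t * u)"
    proof (intro mult_mono powr_mono2)
      show "F (t * 2 ^ n) \<le> F (t * u)"
        using t \<open>T > 0\<close> un by (intro antimonoD[OF \<open>antimono F\<close>] mult_left_mono) auto
    qed (use nu \<open>\<beta> > 0\<close> pos[of "t * 2 ^ n"] in auto)
    finally show "F t \<le> (2 * u) powr \<beta> * F (t * u)" .
  qed
qed

text \<open>Three regimes. For \<open>u \<le> 1\<close> monotonicity bounds the ratio by 1. For
  \<open>u > 1\<close> with \<open>t / u\<close> still beyond \<open>T\<close>, the Potter bound
  runs from \<open>t / u\<close> to \<open>t\<close>. If \<open>t / u\<close> falls below
  \<open>T\<close>, that bound cannot start there; the numerator is at most 1, and a bound on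
  \<open>1 / F t\<close> is enough.\<close>

lemma tail_ratio_bound_regular_variation:
  fixes F :: "real \<Rightarrow> real"
  assumes "antimono F" and pos: "\<And>t. F t > 0" and le1: "\<And>t. F t \<le> 1"
    and "\<beta> > \<alpha>" and "\<beta> > 0"
    and lim: "((\<lambda>t. F (t * 2) / F t) \<longlongrightarrow> 2 powr (- \<alpha>)) at_top"
  obtains C T where "C \<ge> 0" "\<And>t u. t \<ge> T \<Longrightarrow> u > 0 \<Longrightarrow> F (t / u) / F t \<le> 1 + C * u powr \<beta>"
proof -
  from Potter_lower_bound[OF assms(1,2,4,5) lim] obtain T where T: "T > 0"
    and P: "\<And>t u. t \<ge> T \<Longrightarrow> u \<ge> 1 \<Longrightarrow> F t \<le> (2 * u) powr \<beta> * F (t * u)" by blast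
  \<comment> \<open>The value needed when \<open>t / u < T\<close>, where \<open>F t\<close> is
    compared with the fixed number \<open>F T\<close>. As \<open>F T \<le> 1\<close>, it also
    exceeds the constant \<open>2 powr \<beta>\<close> of the middle regime.\<close>
  define C where "C = 2 powr \<beta> / F T"
  have C: "C \<ge> 2 powr \<beta>"
    using pos[of T] le1[of T] by (simp add: C_def field_simps)
  show ?thesis
  proof
    show "C \<ge> 0" using C by (meson order_trans powr_ge_zero)
    fix t u :: real assume t: "t \<ge> T" and u: "u > 0"
    consider "u \<le> 1" | "u > 1" "t / u \<ge> T" | "u > 1" "t / u < T" by linarith
    then show "F (t / u) / F t \<le> 1 + C * u powr \<beta>"
    proof cases
      case 1
      have "t * u \<le> t * 1" using t T 1 by (intro mult_left_mono) auto
      then have "F (t / u) \<le> F t"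
        using u by (intro antimonoD[OF \<open>antimono F\<close>]) (simp add: field_simps)
      then have "F (t / u) / F t \<le> 1" using pos[of t] by simp
      then show ?thesis using \<open>C \<ge> 0\<close> by (smt (verit) mult_nonneg_nonneg powr_ge_zero)
    next
      case 2
      have "F (t / u) \<le> (2 * u) powr \<beta> * F t"
        using P[of "t / u" u] 2 by simp
      then have "F (t / u) / F t \<le> (2 * u) powr \<beta>"
        using pos[of t] by (simp add: field_simps)
      also have "\<dots> = 2 powr \<beta> * u powr \<beta>" using u by (simp add: powr_mult)
      also have "\<dots> \<le> C * u powr \<beta>" using C by (intro mult_right_mono) auto
      finally show ?thesis by simp
    next
      case 3
      \<comment> \<open>The Potter bound runs from \<open>T\<close> to \<open>t\<close>, by the
        factor \<open>t / T\<close>, which is below \<open>u\<close> because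
        \<open>t / u < T\<close>.\<close>
      have "F T \<le> (2 * (t / T)) powr \<beta> * F t"
        using P[of T "t / T"] t T by simp
      also have "\<dots> \<le> (2 * u) powr \<beta> * F t"
        using 3 t T \<open>\<beta> > 0\<close> u pos[of t]
        by (intro mult_right_mono powr_mono2) (auto simp: field_simps)
      finally have "1 / F t \<le> (2 * u) powr \<beta> / F T"
        using pos[of t] pos[of T] by (simp add: field_simps)
      also have "\<dots> = C * u powr \<beta>" using u by (simp add: powr_mult C_def)
      finally have "1 / F t \<le> C * u powr \<beta>" .
      moreover have "F (t / u) / F t \<le> 1 / F t"
        using le1[of "t / u"] pos[of t] by (intro divide_right_mono) auto
      ultimately show ?thesis by simp
    qed
  qed
qed

text \<open>An exact power tail squeezes \<open>t powr \<alpha> * F t\<close> between positive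
  constants for large \<open>t\<close>, so the ratio is bounded with the exponent
  \<open>\<alpha>\<close> itself, and the moment of order \<open>\<alpha>\<close> alone can serve
  for domination.\<close>

lemma tail_ratio_bound_power_tail:
  fixes F :: "real \<Rightarrow> real"
  assumes pos: "\<And>t. F t > 0" and le1: "\<And>t. F t \<le> 1" and "\<alpha> > 0" and "c > 0"
    and lim: "((\<lambda>t. t powr \<alpha> * F t) \<longlongrightarrow> c) at_top"
  obtains C T where "C \<ge> 0" "\<And>t u. t \<ge> T \<Longrightarrow> u > 0 \<Longrightarrow> F (t / u) / F t \<le> C * u powr \<alpha>"
proof -
  have "\<forall>\<^sub>F t in at_top. c / 2 < t powr \<alpha> * F t \<and> t powr \<alpha> * F t < 2 * c"
    using \<open>c > 0\<close> by (intro eventually_conj order_tendstoD[OF lim]) auto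
  then obtain T0 where T0: "\<And>t. t \<ge> T0 \<Longrightarrow> c / 2 < t powr \<alpha> * F t \<and> t powr \<alpha> * F t < 2 * c"
    by (auto simp: eventually_at_top_linorder)
  define T where "T = max T0 1"
  \<comment> \<open>The upper bound must hold on the whole positive half-line, because
    \<open>t / u\<close> may be arbitrarily small: \<open>2 * c\<close> covers arguments beyond
    \<open>T\<close>, and \<open>T powr \<alpha>\<close> covers those below, where
    \<open>F \<le> 1\<close>.\<close>
  define K where "K = max (2 * c) (T powr \<alpha>)"
  have K: "t powr \<alpha> * F t \<le> K" if "t > 0" for t
  proof (cases "t \<ge> T")
    case True
    then show ?thesis using T0[of t] by (simp add: K_def T_def le_max_iff_disj)
  next
    case False
    have "t powr \<alpha> * F t \<le> T powr \<alpha> * 1"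
      using False that \<open>\<alpha> > 0\<close> le1[of t] pos[of t] by (intro mult_mono powr_mono2) auto
    then show ?thesis by (simp add: K_def)
  qed
  show ?thesis
  proof
    show "2 * K / c \<ge> 0" using \<open>c > 0\<close> by (simp add: K_def)
    fix t u :: real assume t: "t \<ge> T" and u: "u > 0"
    have tp: "t > 0" using t by (simp add: T_def)
    have a: "t powr \<alpha> * F (t / u) \<le> K * u powr \<alpha>"
      using K[of "t / u"] tp u by (simp add: powr_divide field_simps)
    have b: "c / 2 < t powr \<alpha> * F t" using T0[of t] t by (simp add: T_def)
    have "F (t / u) / F t = (t powr \<alpha> * F (t / u)) / (t powr \<alpha> * F t)"
      using tp by simp
    also have "\<dots> \<le> (K * u powr \<alpha>) / (c / 2)"
      using a b \<open>c > 0\<close> pos[of "t / u"] by (intro frac_le) (auto intro: order.trans[rotated])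
    finally show "F (t / u) / F t \<le> 2 * K / c * u powr \<alpha>" by (simp add: field_simps)
  qed
qed

section \<open>Images of densities under a common map\<close>

lemma integral_distr_density:
  fixes f :: "'b \<Rightarrow> real"
  assumes [measurable]: "\<theta> \<in> measurable M N" "w \<in> borel_measurable M" "f \<in> borel_measurable N"
    and "\<And>x. w x \<ge> 0"
  shows "(\<integral>x. f x \<partial>distr (density M w) N \<theta>) = (\<integral>x. w x * f (\<theta> x) \<partial>M)"
  using assms by (simp add: integral_distr integral_density)

lemma measure_distr_density:
  fixes w :: "'a \<Rightarrow> real"
  assumes [measurable]: "\<theta> \<in> measurable M N" "A \<in> sets N"
    and int: "integrable M w" and nonneg: "\<And>x. w x \<ge> 0"
  shows "emeasure (distr (density M w) N \<theta>) A = ennreal (\<integral>x. indicator A (\<theta> x) * w x \<partial>M)"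
    and "measure (distr (density M w) N \<theta>) A = (\<integral>x. indicator A (\<theta> x) * w x \<partial>M)"
proof -
  have [measurable]: "w \<in> borel_measurable M" using int by simp
  have "emeasure (distr (density M w) N \<theta>) A = emeasure (density M w) (\<theta> -` A \<inter> space M)"
    by (subst emeasure_distr) auto
  also have "\<dots> = (\<integral>\<^sup>+x. ennreal (indicator A (\<theta> x) * w x) \<partial>M)"
    by (subst emeasure_density) (auto intro!: nn_integral_cong split: split_indicator)
  also have "\<dots> = ennreal (\<integral>x. indicator A (\<theta> x) * w x \<partial>M)"
    using nonneg int
    by (intro nn_integral_eq_integral Bochner_Integration.integrable_bound[OF int])
      (auto simp: indicator_def)
  finally show "emeasure (distr (density M w) N \<theta>) A = ennreal (\<integral>x. indicator A (\<theta> x) * w x \<partial>M)" .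
  then show "measure (distr (density M w) N \<theta>) A = (\<integral>x. indicator A (\<theta> x) * w x \<partial>M)"
    using nonneg by (simp add: measure_def Bochner_Integration.integral_nonneg)
qed

lemma prob_space_distr_density:
  fixes w :: "'a \<Rightarrow> real"
  assumes \<theta> [measurable]: "\<theta> \<in> measurable M N"
    and "integrable M w" "\<And>x. w x \<ge> 0" "(\<integral>x. w x \<partial>M) = 1"
  shows "prob_space (distr (density M w) N \<theta>)"
proof (rule prob_spaceI)
  have "(\<integral>x. indicator (space N) (\<theta> x) * w x \<partial>M) = (\<integral>x. w x \<partial>M)"
    using measurable_space[OF \<theta>] by (intro Bochner_Integration.integral_cong) auto
  then show "emeasure (distr (density M w) N \<theta>) (space (distr (density M w) N \<theta>)) = 1"
    using assms by (simp add: measure_distr_density)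
qed

text \<open>Both integrals pull back to \<open>M\<close>, where their difference is the integral of
  \<open>(w - v)\<close> times a function bounded by \<open>B\<close>. This single estimate serves
  both modes of convergence: indicators give total variation, bounded continuous functions give weak
  convergence.\<close>

lemma abs_integral_distr_density_diff_le:
  fixes w v :: "'a \<Rightarrow> real" and f :: "'b \<Rightarrow> real"
  assumes \<theta> [measurable]: "\<theta> \<in> measurable M N" and f [measurable]: "f \<in> borel_measurable N"
    and bound: "\<And>x. x \<in> space N \<Longrightarrow> \<bar>f x\<bar> \<le> B"
    and w: "integrable M w" "\<And>x. w x \<ge> 0" and v: "integrable M v" "\<And>x. v x \<ge> 0"
  shows "\<bar>(\<integral>x. f x \<partial>distr (density M w) N \<theta>) - (\<integral>x. f x \<partial>distr (density M v) N \<theta>)\<bar>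
    \<le> B * (\<integral>x. \<bar>w x - v x\<bar> \<partial>M)"
proof -
  have [measurable]: "w \<in> borel_measurable M" "v \<in> borel_measurable M" using w v by auto
  have bd: "\<bar>f (\<theta> x)\<bar> \<le> B" if "x \<in> space M" for x
    using bound measurable_space[OF \<theta>] that by blast
  have int: "integrable M (\<lambda>x. u x * f (\<theta> x))" if "integrable M u" for u :: "'a \<Rightarrow> real"
  proof (rule Bochner_Integration.integrable_bound)
    show "integrable M (\<lambda>x. B * u x)" using that by simp
    show "AE x in M. norm (u x * f (\<theta> x)) \<le> norm (B * u x)"
    proof (rule AE_I2)
      fix x assume "x \<in> space M"
      then have "\<bar>f (\<theta> x)\<bar> \<le> \<bar>B\<bar>" using bd by fastforce
      then show "norm (u x * f (\<theta> x)) \<le> norm (B * u x)"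
        by (simp add: abs_mult mult.commute[of "\<bar>u x\<bar>"] mult_right_mono)
    qed
  qed (use that in measurable)
  have "(\<integral>x. f x \<partial>distr (density M w) N \<theta>) - (\<integral>x. f x \<partial>distr (density M v) N \<theta>)
    = (\<integral>x. (w x - v x) * f (\<theta> x) \<partial>M)"
    using w v int[of w] int[of v] by (simp add: integral_distr_density left_diff_distrib)
  also have "\<bar>\<dots>\<bar> \<le> (\<integral>x. \<bar>(w x - v x) * f (\<theta> x)\<bar> \<partial>M)"
    using integral_norm_bound[of M "\<lambda>x. (w x - v x) * f (\<theta> x)"] by simp
  also have "\<dots> \<le> (\<integral>x. B * \<bar>w x - v x\<bar> \<partial>M)"
  proof (rule integral_mono)
    fix x assume "x \<in> space M"
    then show "\<bar>(w x - v x) * f (\<theta> x)\<bar> \<le> B * \<bar>w x - v x\<bar>"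
      using bd by (simp add: abs_mult mult.commute[of "\<bar>w x - v x\<bar>"] mult_right_mono)
  qed (use w v int[of "\<lambda>x. w x - v x"] in auto)
  finally show ?thesis by simp
qed

lemma tv_dist_distr_density_le:
  fixes w v :: "'a \<Rightarrow> real"
  assumes \<theta> [measurable]: "\<theta> \<in> measurable M N"
    and w: "integrable M w" "\<And>x. w x \<ge> 0" and v: "integrable M v" "\<And>x. v x \<ge> 0"
  shows "0 \<le> tv_dist (distr (density M w) N \<theta>) (distr (density M v) N \<theta>)"
    and "tv_dist (distr (density M w) N \<theta>) (distr (density M v) N \<theta>) \<le> (\<integral>x. \<bar>w x - v x\<bar> \<partial>M)"
proof -
  let ?\<mu> = "distr (density M w) N \<theta>" and ?\<nu> = "distr (density M v) N \<theta>"
  have le: "\<bar>measure ?\<mu> A - measure ?\<nu> A\<bar> \<le> (\<integral>x. \<bar>w x - v x\<bar> \<partial>M)" if "A \<in> sets N" for A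
  proof -
    have "\<bar>indicator A x :: real\<bar> \<le> 1" for x :: 'b
      by (simp add: indicator_def)
    from abs_integral_distr_density_diff_le[OF \<theta> borel_measurable_indicator[OF that] this w v]
    show ?thesis
      using sets.sets_into_space[OF that] by (simp add: Int_absorb2)
  qed
  show "tv_dist ?\<mu> ?\<nu> \<le> (\<integral>x. \<bar>w x - v x\<bar> \<partial>M)"
    unfolding tv_dist_def by (intro cSUP_least) (use le in auto)
  \<comment> \<open>A real supremum dominates its terms only when the family is bounded above; the
    empty set then contributes the term 0.\<close>
  have "bdd_above ((\<lambda>A. \<bar>measure ?\<mu> A - measure ?\<nu> A\<bar>) ` sets ?\<nu>)"
    using le by (intro bdd_aboveI[of _ "\<integral>x. \<bar>w x - v x\<bar> \<partial>M"]) auto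
  from cSUP_upper[OF _ this, of "{}"] show "0 \<le> tv_dist ?\<mu> ?\<nu>"
    by (simp add: tv_dist_def)
qed

section \<open>The product model and its basic properties\<close>

locale homogeneous_product = prob_space M
  for M :: "'a measure" +
  fixes \<xi> :: "'a \<Rightarrow> real" and \<eta> :: "'a \<Rightarrow> real ^ 'k"
    and \<tau> :: "real ^ 'k \<Rightarrow> real" and \<alpha> :: real
  assumes indep: "indep_rvs M \<xi> \<eta>"
    and xi_nonneg: "AE \<omega> in M. \<xi> \<omega> \<ge> 0"
    and alpha_pos: "\<alpha> > 0"
    and reg_var: "regularly_varying_tail M \<xi> \<alpha>"
    and tau_nonneg: "\<And>x. \<tau> x \<ge> 0"
    and tau_cont: "continuous_on UNIV \<tau>"
    and tau_hom: "one_homogeneous \<tau>"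
    and moment_integrable: "integrable M (\<lambda>\<omega>. \<tau> (\<eta> \<omega>) powr \<alpha>)"
    and moment_pos: "(\<integral>\<omega>. \<tau> (\<eta> \<omega>) powr \<alpha> \<partial>M) > 0"
    and tail_or_moment:
      "(\<exists>c>0. ((\<lambda>t. t powr \<alpha> * measure M {\<omega>\<in>space M. \<xi> \<omega> > t}) \<longlongrightarrow> c) at_top) \<or>
       (\<exists>\<delta>>0. integrable M (\<lambda>\<omega>. \<tau> (\<eta> \<omega>) powr (\<alpha> + \<delta>)))"
begin

definition F :: "real \<Rightarrow> real" where
  "F t = measure M {\<omega>\<in>space M. \<xi> \<omega> > t}"

definition Z :: "'a \<Rightarrow> real ^ 'k" where
  "Z \<omega> = \<xi> \<omega> *\<^sub>R \<eta> \<omega>"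

definition m :: real where
  "m = (\<integral>\<omega>. \<tau> (\<eta> \<omega>) powr \<alpha> \<partial>M)"

definition P :: "real \<Rightarrow> real" where
  "P t = measure M {\<omega>\<in>space M. \<tau> (Z \<omega>) > t}"

text \<open>Conditional on \<open>\<eta>\<close>, the probability that \<open>\<tau> Z > t\<close> (for \<open>t \<ge> 0\<close>).\<close>
definition G :: "real \<Rightarrow> 'a \<Rightarrow> real" where
  "G t \<omega> = (if \<tau> (\<eta> \<omega>) > 0 then F (t / \<tau> (\<eta> \<omega>)) else 0)"

text \<open>Redefining \<open>\<eta> / \<tau> \<eta>\<close> where \<open>\<tau> \<eta> = 0\<close>, an event of zero weight, makes it map into the sphere.\<close>
definition \<theta> :: "'a \<Rightarrow> real ^ 'k" where
  "\<theta> \<omega> = (if \<tau> (\<eta> \<omega>) > 0 then \<eta> \<omega> /\<^sub>R \<tau> (\<eta> \<omega>) else (SOME x. \<tau> x = 1))"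

text \<open>Written as an image under \<open>\<theta>\<close>, because the angular laws turn out to
  have the same form with other densities; \<open>measure_sigma\<close> recovers the explicit
  formula.\<close>

definition \<sigma> :: "(real ^ 'k) measure" where
  "\<sigma> = distr (density M (\<lambda>\<omega>. \<tau> (\<eta> \<omega>) powr \<alpha> / m)) (sphere_borel \<tau>) \<theta>"

lemma m_pos: "m > 0"
  using moment_pos by (simp add: m_def)

lemma xi_measurable [measurable]: "\<xi> \<in> borel_measurable M"
  and eta_measurable [measurable]: "\<eta> \<in> borel_measurable M"
  using indep by (auto simp: indep_rvs_def)

lemma tau_measurable [measurable]: "\<tau> \<in> borel_measurable borel"
  using tau_cont by (rule borel_measurable_continuous_onI)

lemma Z_measurable [measurable]: "Z \<in> borel_measurable M"
  unfolding Z_def by measurable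

lemma tau_scale: "c \<ge> 0 \<Longrightarrow> \<tau> (c *\<^sub>R x) = c * \<tau> x"
  using tau_hom by (auto simp: one_homogeneous_def)

lemma level_sphere_borel: "level_sphere \<tau> \<in> sets borel"
proof -
  have "closed (\<tau> -` {1})"
    using tau_cont by (intro closed_vimage) (auto simp: continuous_on_eq_continuous_at)
  moreover have "level_sphere \<tau> = \<tau> -` {1}" by (auto simp: level_sphere_def)
  ultimately show ?thesis by simp
qed

lemma sphere_sets_borel: "B \<in> sets (sphere_borel \<tau>) \<Longrightarrow> B \<in> sets borel"
  using level_sphere_borel by (auto simp: sets_restrict_space)

text \<open>The default point chosen by \<open>SOME\<close> exists: the positive moment forces
  \<open>\<tau> (\<eta> \<omega>) > 0\<close> for some \<open>\<omega>\<close>, and normalising that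
  vector gives a point of the sphere.\<close>

lemma theta_in_sphere: "\<theta> \<omega> \<in> level_sphere \<tau>"
proof -
  have "\<exists>\<omega>. \<tau> (\<eta> \<omega>) > 0"
  proof (rule ccontr)
    assume "\<not> ?thesis"
    then have "\<tau> (\<eta> \<omega>) = 0" for \<omega>
      using tau_nonneg[of "\<eta> \<omega>"] by (metis order_antisym_conv not_less)
    then show False using moment_pos by simp
  qed
  then obtain x where "\<tau> (\<eta> x) > 0" by blast
  then have "\<tau> (\<eta> x /\<^sub>R \<tau> (\<eta> x)) = 1" by (simp add: tau_scale)
  then have "\<tau> (SOME x. \<tau> x = 1) = 1" by (rule someI)
  then show ?thesis by (simp add: \<theta>_def level_sphere_def tau_scale)
qed

lemma theta_measurable [measurable]: "\<theta> \<in> measurable M (sphere_borel \<tau>)"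
proof (rule measurable_restrict_space2)
  show "\<theta> \<in> borel_measurable M" unfolding \<theta>_def by measurable
qed (use theta_in_sphere in auto)

lemma F_antimono: "antimono F"
  unfolding F_def by (intro antimonoI finite_measure_mono) auto

lemma F_le_1: "F t \<le> 1"
  by (simp add: F_def)

lemma F_measurable [measurable]: "F \<in> borel_measurable borel"
proof -
  have "mono (\<lambda>t. - F t)"
    using F_antimono by (auto simp: mono_def antimono_def)
  from borel_measurable_uminus[OF borel_measurable_mono[OF this]] show ?thesis by simp
qed

lemma F_ratio: "x > 0 \<Longrightarrow> ((\<lambda>t. F (t * x) / F t) \<longlongrightarrow> x powr (- \<alpha>)) at_top"
  using reg_var by (simp add: regularly_varying_tail_def F_def)

text \<open>At \<open>x = 1\<close> the quotient \<open>F t / F t\<close> tends to 1, whereas it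
  would be 0 wherever \<open>F t = 0\<close>. So \<open>F\<close> is nonzero at all large arguments,
  and monotonicity carries positivity down to every \<open>t\<close>.\<close>

lemma F_pos: "F t > 0"
proof -
  have "((\<lambda>t. F (t * 1) / F t) \<longlongrightarrow> 1) at_top"
    using F_ratio[of 1] by simp
  from order_tendstoD(1)[OF this, of "1/2"] obtain T where "\<And>t. t \<ge> T \<Longrightarrow> F t \<noteq> 0"
    by (auto simp: eventually_at_top_linorder) force
  then have "F (max t T) \<noteq> 0" by simp
  moreover have "F (max t T) \<le> F t" by (intro antimonoD[OF F_antimono]) simp
  moreover have "F (max t T) \<ge> 0" by (simp add: F_def)
  ultimately show ?thesis by linarith
qed

lemma G_nonneg: "G t \<omega> \<ge> 0"
  using F_pos by (simp add: G_def less_imp_le)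

lemma G_integrable: "integrable M (G t)"
proof (rule integrable_const_bound[where B=1])
  show "G t \<in> borel_measurable M" unfolding G_def by measurable
qed (use F_pos F_le_1 in \<open>auto simp: G_def less_imp_le\<close>)

lemma G_measurable [measurable]: "G t \<in> borel_measurable M"
  using G_integrable by simp

section \<open>Tail events and angular laws as integrals over \<open>\<eta>\<close>\<close>

lemma prob_tail_theta:
  assumes "t \<ge> 0" and B: "B \<in> sets (sphere_borel \<tau>)"
  shows "measure M {\<omega>\<in>space M. \<tau> (Z \<omega>) > t \<and> \<theta> \<omega> \<in> B} = (\<integral>\<omega>. indicator B (\<theta> \<omega>) * G t \<omega> \<partial>M)"
proof -
  note [measurable] = sphere_sets_borel[OF B] B
  \<comment> \<open>The condition \<open>x * \<tau> y > t\<close> is solved for \<open>x\<close>, so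
    that each section in \<open>x\<close> is empty or a tail event of \<open>\<xi>\<close>. Points
    with \<open>\<tau> y = 0\<close> drop out since \<open>t \<ge> 0\<close>.\<close>
  define S where "S = {(x, y). \<tau> y > 0 \<and> x > t / \<tau> y \<and> y /\<^sub>R \<tau> y \<in> B}"
  have "Measurable.pred (borel \<Otimes>\<^sub>M borel)
    (\<lambda>z::real \<times> (real ^ 'k). \<tau> (snd z) > 0 \<and> fst z > t / \<tau> (snd z) \<and> snd z /\<^sub>R \<tau> (snd z) \<in> B)"
    by measurable
  then have S: "S \<in> sets (borel \<Otimes>\<^sub>M borel)"
    by (simp add: S_def pred_def space_pair_measure case_prod_unfold)
  have [measurable]: "{\<omega>\<in>space M. (\<xi> \<omega>, \<eta> \<omega>) \<in> S} \<in> events"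
    using S by measurable
  have "measure M {\<omega>\<in>space M. \<tau> (Z \<omega>) > t \<and> \<theta> \<omega> \<in> B} = measure M {\<omega>\<in>space M. (\<xi> \<omega>, \<eta> \<omega>) \<in> S}"
  proof (rule finite_measure_eq_AE)
    \<comment> \<open>Only almost everywhere: homogeneity concerns nonnegative scalars, and
      \<open>\<xi>\<close> is nonnegative almost surely.\<close>
    show "AE \<omega> in M. (\<omega> \<in> {\<omega>\<in>space M. \<tau> (Z \<omega>) > t \<and> \<theta> \<omega> \<in> B}) =
        (\<omega> \<in> {\<omega>\<in>space M. (\<xi> \<omega>, \<eta> \<omega>) \<in> S})"
      using xi_nonneg
    proof eventually_elim
      case (elim \<omega>)
      then have "\<tau> (Z \<omega>) = \<xi> \<omega> * \<tau> (\<eta> \<omega>)" by (simp add: Z_def tau_scale)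
      then show ?case
        using \<open>t \<ge> 0\<close> tau_nonneg[of "\<eta> \<omega>"]
        by (cases "\<tau> (\<eta> \<omega>) = 0") (auto simp: S_def \<theta>_def field_simps)
    qed
  qed measurable
  also have "\<dots> = (\<integral>\<omega>. measure M {\<omega>'\<in>space M. (\<xi> \<omega>', \<eta> \<omega>) \<in> S} \<partial>M)"
    by (rule indep_rvs_measure_Fubini[OF prob_space_axioms indep S])
  also have "\<dots> = (\<integral>\<omega>. indicator B (\<theta> \<omega>) * G t \<omega> \<partial>M)"
    by (intro Bochner_Integration.integral_cong) (auto simp: S_def \<theta>_def G_def F_def indicator_def)
  finally show ?thesis .
qed

lemma P_eq_integral: "t \<ge> 0 \<Longrightarrow> P t = (\<integral>\<omega>. G t \<omega> \<partial>M)"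
proof -
  assume "t \<ge> 0"
  moreover have "level_sphere \<tau> \<in> sets (sphere_borel \<tau>)"
    using sets.top[of "sphere_borel \<tau>"] by (simp add: space_restrict_space)
  ultimately show ?thesis
    using prob_tail_theta[of t "level_sphere \<tau>"] theta_in_sphere by (simp add: P_def)
qed

text \<open>On the conditioning event the positive scalar \<open>\<xi>\<close> cancels, so almost
  surely \<open>Z\<close> and \<open>\<eta>\<close> have the same direction \<open>\<theta>\<close>.
  The mass of \<open>B\<close> is then the quotient of the integral in
  \<open>prob_tail_theta\<close> by \<open>P t\<close>.\<close>

lemma angular_law_eq:
  assumes t: "t \<ge> 0" and pos: "P t > 0"
  shows "angular_law M Z \<tau> t = distr (density M (\<lambda>\<omega>. G t \<omega> / P t)) (sphere_borel \<tau>) \<theta>"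
proof (rule measure_eqI)
  let ?A = "{\<omega>\<in>space M. \<tau> (Z \<omega>) > t}" and ?X = "\<lambda>\<omega>. Z \<omega> /\<^sub>R \<tau> (Z \<omega>)"
  let ?R = "restrict_space M ?A"
  have A [measurable]: "?A \<in> sets M" by measurable
  have spR: "space ?R = ?A" by (auto simp: space_restrict_space)
  \<comment> \<open>On \<open>?A\<close> the divisor exceeds \<open>t \<ge> 0\<close>, so
    normalisation does land in the sphere; elsewhere it may divide by zero.\<close>
  have X: "?X \<in> measurable ?R (sphere_borel \<tau>)"
  proof (rule measurable_restrict_space3)
    show "?X \<in> ?A \<rightarrow> level_sphere \<tau>"
      using t by (auto simp: level_sphere_def tau_scale)
  qed measurable
  then have XU: "?X \<in> measurable (uniform_measure ?R ?A) (sphere_borel \<tau>)"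
    by simp
  show "sets (angular_law M Z \<tau> t) =
      sets (distr (density M (\<lambda>\<omega>. G t \<omega> / P t)) (sphere_borel \<tau>) \<theta>)"
    by (simp add: angular_law_def cond_law_def)
  fix B assume "B \<in> sets (angular_law M Z \<tau> t)"
  then have B [measurable]: "B \<in> sets (sphere_borel \<tau>)"
    by (simp add: angular_law_def cond_law_def)
  note [measurable] = sphere_sets_borel[OF B]
  have vs: "?X -` B \<inter> ?A \<in> sets ?R"
    using measurable_sets[OF X B] by (simp add: spR)
  have eqset: "?X -` B \<inter> ?A = {\<omega>\<in>space M. \<tau> (Z \<omega>) > t \<and> ?X \<omega> \<in> B}" by auto
  have "emeasure (angular_law M Z \<tau> t) B = emeasure (uniform_measure ?R ?A) (?X -` B \<inter> ?A)"
    unfolding angular_law_def cond_law_def by (subst emeasure_distr[OF XU B]) (simp add: spR)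
  also have "\<dots> = emeasure ?R (?A \<inter> (?X -` B \<inter> ?A)) / emeasure ?R ?A"
    using vs sets.top[of ?R] by (intro emeasure_uniform_measure) (simp_all add: spR)
  also have "\<dots> = emeasure M (?X -` B \<inter> ?A) / emeasure M ?A"
    by (subst (1 2) emeasure_restrict_space)
      (auto simp: Int_absorb1 intro!: arg_cong2[where f="(/)"] arg_cong[where f="emeasure M"])
  also have "emeasure M (?X -` B \<inter> ?A) = emeasure M {\<omega>\<in>space M. \<tau> (Z \<omega>) > t \<and> \<theta> \<omega> \<in> B}"
    unfolding eqset
  proof (rule emeasure_eq_AE)
    show "AE \<omega> in M. (\<omega> \<in> {\<omega>\<in>space M. \<tau> (Z \<omega>) > t \<and> ?X \<omega> \<in> B}) =
        (\<omega> \<in> {\<omega>\<in>space M. \<tau> (Z \<omega>) > t \<and> \<theta> \<omega> \<in> B})"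
      using xi_nonneg
    proof eventually_elim
      case (elim \<omega>)
      then have tz: "\<tau> (Z \<omega>) = \<xi> \<omega> * \<tau> (\<eta> \<omega>)" by (simp add: Z_def tau_scale)
      have "?X \<omega> = \<theta> \<omega>" if "\<tau> (Z \<omega>) > t"
      proof -
        have "\<xi> \<omega> * \<tau> (\<eta> \<omega>) > 0" using that t tz by simp
        then have "\<xi> \<omega> > 0" "\<tau> (\<eta> \<omega>) > 0"
          using elim tau_nonneg[of "\<eta> \<omega>"] by (auto simp: zero_less_mult_iff)
        then show ?thesis unfolding tz by (simp add: \<theta>_def Z_def)
      qed
      then show ?case by auto
    qed
  qed measurable
  also have "\<dots> / emeasure M ?A = ennreal ((\<integral>\<omega>. indicator B (\<theta> \<omega>) * G t \<omega> \<partial>M) / P t)"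
    using pos prob_tail_theta[OF t B]
    by (simp add: emeasure_eq_measure divide_ennreal P_def[symmetric] Bochner_Integration.integral_nonneg G_nonneg)
  also have "\<dots> = emeasure (distr (density M (\<lambda>\<omega>. G t \<omega> / P t)) (sphere_borel \<tau>) \<theta>) B"
    using pos G_integrable G_nonneg by (subst measure_distr_density) auto
  finally show "emeasure (angular_law M Z \<tau> t) B =
      emeasure (distr (density M (\<lambda>\<omega>. G t \<omega> / P t)) (sphere_borel \<tau>) \<theta>) B" .
qed

section \<open>Domination and convergence of the densities\<close>

lemma G_ratio_dominated:
  obtains D T where "integrable M D" "\<And>\<omega>. D \<omega> \<ge> 0" "\<And>t \<omega>. t \<ge> T \<Longrightarrow> G t \<omega> / F t \<le> D \<omega>"
proof -
  \<comment> \<open>The deterministic bound is used at \<open>u = \<tau> (\<eta> \<omega>)\<close>;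
    nonnegativity of \<open>B\<close> covers \<open>\<tau> (\<eta> \<omega>) = 0\<close>, where
    \<open>G\<close> vanishes.\<close>
  have Gle: "G t \<omega> / F t \<le> B (\<tau> (\<eta> \<omega>))"
    if "\<And>u. u > 0 \<Longrightarrow> F (t / u) / F t \<le> B u" "\<And>u. B u \<ge> 0" for t \<omega> and B :: "real \<Rightarrow> real"
    using that by (simp add: G_def)
  from tail_or_moment show ?thesis
  proof
    assume "\<exists>c>0. ((\<lambda>t. t powr \<alpha> * measure M {\<omega>\<in>space M. \<xi> \<omega> > t}) \<longlongrightarrow> c) at_top"
    then obtain c where "c > 0" "((\<lambda>t. t powr \<alpha> * F t) \<longlongrightarrow> c) at_top"
      by (auto simp: F_def)
    from tail_ratio_bound_power_tail[OF F_pos F_le_1 alpha_pos this] obtain C T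
      where C: "C \<ge> 0" "\<And>t u. t \<ge> T \<Longrightarrow> u > 0 \<Longrightarrow> F (t / u) / F t \<le> C * u powr \<alpha>" by blast
    show ?thesis
    proof (rule that)
      show "G t \<omega> / F t \<le> C * \<tau> (\<eta> \<omega>) powr \<alpha>" if "t \<ge> T" for t \<omega>
        using C that by (intro Gle) auto
    qed (use C moment_integrable in auto)
  next
    assume "\<exists>\<delta>>0. integrable M (\<lambda>\<omega>. \<tau> (\<eta> \<omega>) powr (\<alpha> + \<delta>))"
    then obtain \<delta> where d: "\<delta> > 0" "integrable M (\<lambda>\<omega>. \<tau> (\<eta> \<omega>) powr (\<alpha> + \<delta>))" by blast
    from tail_ratio_bound_regular_variation[OF F_antimono F_pos F_le_1 _ _ F_ratio, where \<beta> = "\<alpha> + \<delta>"]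
    obtain C T where C: "C \<ge> 0"
      "\<And>t u. t \<ge> T \<Longrightarrow> u > 0 \<Longrightarrow> F (t / u) / F t \<le> 1 + C * u powr (\<alpha> + \<delta>)"
      using d alpha_pos by auto
    show ?thesis
    proof (rule that)
      show "G t \<omega> / F t \<le> 1 + C * \<tau> (\<eta> \<omega>) powr (\<alpha> + \<delta>)" if "t \<ge> T" for t \<omega>
        using C that by (intro Gle) auto
    qed (use C d in auto)
  qed
qed

text \<open>Regular variation at \<open>x = 1 / \<tau> (\<eta> \<omega>)\<close>. If
  \<open>\<tau> (\<eta> \<omega>) = 0\<close>, both sides are 0, because
  \<open>0 powr \<alpha> = 0\<close>.\<close>

lemma G_ratio_tendsto: "((\<lambda>t. G t \<omega> / F t) \<longlongrightarrow> \<tau> (\<eta> \<omega>) powr \<alpha>) at_top"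
proof (cases "\<tau> (\<eta> \<omega>) > 0")
  case True
  with F_ratio[of "1 / \<tau> (\<eta> \<omega>)"] show ?thesis
    by (simp add: G_def powr_minus powr_divide)
next
  case False
  then have "\<tau> (\<eta> \<omega>) = 0" using tau_nonneg[of "\<eta> \<omega>"] by simp
  then show ?thesis by (simp add: G_def)
qed

lemma P_ratio_tendsto: "((\<lambda>t. P t / F t) \<longlongrightarrow> m) at_top"
proof -
  obtain D T where D: "integrable M D" "\<And>\<omega>. D \<omega> \<ge> 0"
    "\<And>t \<omega>. t \<ge> T \<Longrightarrow> G t \<omega> / F t \<le> D \<omega>" using G_ratio_dominated by blast
  have "((\<lambda>t. \<integral>\<omega>. G t \<omega> / F t \<partial>M) \<longlongrightarrow> (\<integral>\<omega>. \<tau> (\<eta> \<omega>) powr \<alpha> \<partial>M)) at_top"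
  proof (rule integral_dominated_convergence_at_top)
    show "\<forall>\<^sub>F t in at_top. AE \<omega> in M. norm (G t \<omega> / F t) \<le> D \<omega>"
      using eventually_ge_at_top[of T]
    proof eventually_elim
      case (elim t)
      then show ?case using D(3) G_nonneg F_pos less_imp_le[OF F_pos] by simp
    qed
    show "AE \<omega> in M. ((\<lambda>t. G t \<omega> / F t) \<longlongrightarrow> \<tau> (\<eta> \<omega>) powr \<alpha>) at_top"
      using G_ratio_tendsto by simp
  qed (use D(1) in measurable)
  then show ?thesis
    unfolding m_def
  proof (rule Lim_transform_eventually)
    show "\<forall>\<^sub>F t in at_top. (\<integral>\<omega>. G t \<omega> / F t \<partial>M) = P t / F t"
      using eventually_ge_at_top[of 0] by eventually_elim (simp add: P_eq_integral)
  qed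
qed

text \<open>Makes the conditioning legitimate for large \<open>t\<close> and keeps the normalisation
  \<open>P t / F t\<close> away from 0, as domination of \<open>G t / P t\<close> requires.\<close>

lemma P_eventually_pos: "\<forall>\<^sub>F t in at_top. t \<ge> 0 \<and> P t > 0 \<and> P t / F t > m / 2"
proof -
  have "\<forall>\<^sub>F t in at_top. P t / F t > m / 2"
    using m_pos by (intro order_tendstoD(1)[OF P_ratio_tendsto]) simp
  then show ?thesis
    using eventually_ge_at_top[of 0]
  proof eventually_elim
    case (elim t)
    then have "P t / F t > 0" using m_pos by linarith
    with elim F_pos[of t] show ?case by (simp add: zero_less_divide_iff)
  qed
qed

lemma density_L1_tendsto:
  "((\<lambda>t. \<integral>\<omega>. \<bar>G t \<omega> / P t - \<tau> (\<eta> \<omega>) powr \<alpha> / m\<bar> \<partial>M) \<longlongrightarrow> 0) at_top"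
proof -
  obtain D T where D: "integrable M D" "\<And>\<omega>. D \<omega> \<ge> 0"
    "\<And>t \<omega>. t \<ge> T \<Longrightarrow> G t \<omega> / F t \<le> D \<omega>" using G_ratio_dominated by blast
  have eq: "G t \<omega> / P t = (G t \<omega> / F t) / (P t / F t)" for t \<omega>
    using F_pos[of t] by simp
  have "((\<lambda>t. \<integral>\<omega>. \<bar>G t \<omega> / P t - \<tau> (\<eta> \<omega>) powr \<alpha> / m\<bar> \<partial>M) \<longlongrightarrow> (\<integral>\<omega>. 0 \<partial>M)) at_top"
  proof (rule integral_dominated_convergence_at_top)
    \<comment> \<open>For nonnegative numbers \<open>\<bar>x - y\<bar> \<le> x + y\<close>; the
      first summand bounds \<open>G t \<omega> / P t\<close> through
      \<open>G t \<omega> / F t \<le> D \<omega>\<close> and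
      \<open>P t / F t \<ge> m / 2\<close>.\<close>
    let ?w = "\<lambda>\<omega>. D \<omega> / (m / 2) + \<tau> (\<eta> \<omega>) powr \<alpha> / m"
    show "integrable M ?w" using D moment_integrable by simp
    show "\<forall>\<^sub>F t in at_top. AE \<omega> in M. norm \<bar>G t \<omega> / P t - \<tau> (\<eta> \<omega>) powr \<alpha> / m\<bar> \<le> ?w \<omega>"
      using eventually_ge_at_top[of T] P_eventually_pos
    proof eventually_elim
      case (elim t)
      show ?case
      proof (rule AE_I2)
        fix \<omega>
        have "G t \<omega> / P t \<le> D \<omega> / (m / 2)"
          unfolding eq
        proof (rule frac_le[OF D(2) D(3)])
          show "m / 2 \<le> P t / F t" using elim by linarith
        qed (use elim m_pos in auto)
        moreover have "G t \<omega> / P t \<ge> 0" using elim G_nonneg by simp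
        moreover have "\<tau> (\<eta> \<omega>) powr \<alpha> / m \<ge> 0" using m_pos by simp
        ultimately show "norm \<bar>G t \<omega> / P t - \<tau> (\<eta> \<omega>) powr \<alpha> / m\<bar> \<le> ?w \<omega>"
          by (simp only: real_norm_def abs_idempotent)
      qed
    qed
    show "AE \<omega> in M. ((\<lambda>t. \<bar>G t \<omega> / P t - \<tau> (\<eta> \<omega>) powr \<alpha> / m\<bar>) \<longlongrightarrow> 0) at_top"
    proof (rule AE_I2)
      fix \<omega>
      have "((\<lambda>t. G t \<omega> / P t) \<longlongrightarrow> \<tau> (\<eta> \<omega>) powr \<alpha> / m) at_top"
        unfolding eq using m_pos by (intro tendsto_divide G_ratio_tendsto P_ratio_tendsto) auto
      then show "((\<lambda>t. \<bar>G t \<omega> / P t - \<tau> (\<eta> \<omega>) powr \<alpha> / m\<bar>) \<longlongrightarrow> 0) at_top"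
        by (intro tendsto_rabs_zero) (simp add: LIM_zero)
    qed
  qed measurable
  then show ?thesis by simp
qed

section \<open>The limit law, the two modes of convergence, and regular variation of
  \<open>Z\<close>\<close>

lemma sigma_density:
  "integrable M (\<lambda>\<omega>. \<tau> (\<eta> \<omega>) powr \<alpha> / m)" "\<And>\<omega>. \<tau> (\<eta> \<omega>) powr \<alpha> / m \<ge> 0"
  "(\<integral>\<omega>. \<tau> (\<eta> \<omega>) powr \<alpha> / m \<partial>M) = 1"
  using moment_integrable m_pos by (auto simp: m_def)

lemma prob_space_sigma: "prob_space \<sigma>"
  unfolding \<sigma>_def by (intro prob_space_distr_density theta_measurable sigma_density)

lemma sets_sigma: "sets \<sigma> = sets (sphere_borel \<tau>)"
  by (simp add: \<sigma>_def)

text \<open>The maps \<open>\<theta>\<close> and \<open>\<eta> / \<tau> \<eta>\<close> differ only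
  where \<open>\<tau> \<eta> = 0\<close>, and there the weight \<open>0 powr \<alpha>\<close> is 0,
  whatever the indicator says.\<close>

lemma measure_sigma:
  assumes "A \<in> sets (sphere_borel \<tau>)"
  shows "measure \<sigma> A =
    1 / m * (\<integral>\<omega>. indicator A (\<eta> \<omega> /\<^sub>R \<tau> (\<eta> \<omega>)) * \<tau> (\<eta> \<omega>) powr \<alpha> \<partial>M)"
proof -
  have "measure \<sigma> A = (\<integral>\<omega>. indicator A (\<theta> \<omega>) * (\<tau> (\<eta> \<omega>) powr \<alpha> / m) \<partial>M)"
    unfolding \<sigma>_def using sigma_density assms by (intro measure_distr_density) auto
  also have "\<dots> = (\<integral>\<omega>. 1 / m * (indicator A (\<eta> \<omega> /\<^sub>R \<tau> (\<eta> \<omega>)) * \<tau> (\<eta> \<omega>) powr \<alpha>) \<partial>M)"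
  proof (rule Bochner_Integration.integral_cong)
    fix \<omega>
    show "indicator A (\<theta> \<omega>) * (\<tau> (\<eta> \<omega>) powr \<alpha> / m) =
      1 / m * (indicator A (\<eta> \<omega> /\<^sub>R \<tau> (\<eta> \<omega>)) * \<tau> (\<eta> \<omega>) powr \<alpha>)"
      using tau_nonneg[of "\<eta> \<omega>"] by (cases "\<tau> (\<eta> \<omega>) = 0") (auto simp: \<theta>_def)
  qed simp
  also have "\<dots> = 1 / m * (\<integral>\<omega>. indicator A (\<eta> \<omega> /\<^sub>R \<tau> (\<eta> \<omega>)) * \<tau> (\<eta> \<omega>) powr \<alpha> \<partial>M)"
    by simp
  finally show ?thesis .
qed

lemma tv_dist_tendsto: "((\<lambda>t. tv_dist (angular_law M Z \<tau> t) \<sigma>) \<longlongrightarrow> 0) at_top"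
proof (rule tendsto_sandwich[OF _ _ tendsto_const density_L1_tendsto])
  have "\<forall>\<^sub>F t in at_top. 0 \<le> tv_dist (angular_law M Z \<tau> t) \<sigma> \<and>
    tv_dist (angular_law M Z \<tau> t) \<sigma> \<le> (\<integral>\<omega>. \<bar>G t \<omega> / P t - \<tau> (\<eta> \<omega>) powr \<alpha> / m\<bar> \<partial>M)"
    using P_eventually_pos
  proof eventually_elim
    case (elim t)
    then show ?case
      using tv_dist_distr_density_le[OF theta_measurable, of "\<lambda>\<omega>. G t \<omega> / P t"]
        sigma_density G_integrable G_nonneg by (simp add: angular_law_eq \<sigma>_def)
  qed
  then show "\<forall>\<^sub>F t in at_top. 0 \<le> tv_dist (angular_law M Z \<tau> t) \<sigma>"
    "\<forall>\<^sub>F t in at_top. tv_dist (angular_law M Z \<tau> t) \<sigma> \<le>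
      (\<integral>\<omega>. \<bar>G t \<omega> / P t - \<tau> (\<eta> \<omega>) powr \<alpha> / m\<bar> \<partial>M)"
    by (auto elim: eventually_mono)
qed

text \<open>The L1 distance of the densities, multiplied by a bound for the test function on the
  sphere, controls the difference of the integrals.\<close>

lemma angular_law_weakly_converges:
  "weakly_converges_on (level_sphere \<tau>) (angular_law M Z \<tau>) \<sigma> at_top"
  unfolding weakly_converges_on_def
proof (intro allI impI, elim conjE)
  fix f :: "real ^ 'k \<Rightarrow> real"
  assume cont: "continuous_on (level_sphere \<tau>) f" and "bounded (f ` level_sphere \<tau>)"
  then obtain B where B: "\<And>x. x \<in> level_sphere \<tau> \<Longrightarrow> \<bar>f x\<bar> \<le> B"
    by (auto simp: bounded_iff)
  have f: "f \<in> borel_measurable (sphere_borel \<tau>)"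
    using cont by (rule borel_measurable_continuous_on_restrict)
  have "\<forall>\<^sub>F t in at_top. norm ((\<integral>x. f x \<partial>angular_law M Z \<tau> t) - (\<integral>x. f x \<partial>\<sigma>)) \<le>
    B * (\<integral>\<omega>. \<bar>G t \<omega> / P t - \<tau> (\<eta> \<omega>) powr \<alpha> / m\<bar> \<partial>M)"
    using P_eventually_pos
  proof eventually_elim
    case (elim t)
    then show ?case
      using abs_integral_distr_density_diff_le[OF theta_measurable f, of B "\<lambda>\<omega>. G t \<omega> / P t"]
        B sigma_density G_integrable G_nonneg
      by (simp add: angular_law_eq \<sigma>_def space_restrict_space)
  qed
  moreover have "((\<lambda>t. B * (\<integral>\<omega>. \<bar>G t \<omega> / P t - \<tau> (\<eta> \<omega>) powr \<alpha> / m\<bar> \<partial>M)) \<longlongrightarrow> 0) at_top"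
    using tendsto_mult_right_zero[OF density_L1_tendsto] .
  ultimately have "((\<lambda>t. (\<integral>x. f x \<partial>angular_law M Z \<tau> t) - (\<integral>x. f x \<partial>\<sigma>)) \<longlongrightarrow> 0) at_top"
    by (rule Lim_null_comparison)
  then show "((\<lambda>t. \<integral>x. f x \<partial>angular_law M Z \<tau> t) \<longlongrightarrow> (\<integral>x. f x \<partial>\<sigma>)) at_top"
    by (rule LIM_zero_cancel)
qed

lemma RV_Z:
  assumes a: "(\<lambda>n. real n * F (a n)) \<longlonglongrightarrow> 1"
  shows "RV M Z \<alpha> a m \<tau> \<sigma>"
proof -
  have "(\<lambda>n. inverse (real n) * (real n * F (a n))) \<longlonglongrightarrow> 0 * 1"
    by (intro tendsto_mult a lim_inverse_n)
  then have F0: "(\<lambda>n. F (a n)) \<longlonglongrightarrow> 0"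
    unfolding mult_zero_left
  proof (rule Lim_transform_eventually)
    \<comment> \<open>At \<open>n = 0\<close> the left side is 0 by convention, so only positive
      \<open>n\<close> are considered.\<close>
    show "\<forall>\<^sub>F n in sequentially. inverse (real n) * (real n * F (a n)) = F (a n)"
      using eventually_gt_at_top[of 0] by eventually_elim simp
  qed
  \<comment> \<open>Eventually \<open>F (a n) < F K\<close> because \<open>F K > 0\<close>; by
    monotonicity \<open>a n \<le> K\<close> is then impossible.\<close>
  have a_top: "filterlim a at_top sequentially"
    unfolding filterlim_at_top
  proof
    fix K
    show "\<forall>\<^sub>F n in sequentially. K \<le> a n"
      using order_tendstoD(2)[OF F0 F_pos[of K]]
    proof eventually_elim
      case (elim n)
      then show ?case using antimonoD[OF F_antimono, of "a n" K] by force
    qed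
  qed
  have "(\<lambda>n. real n * P (t * a n)) \<longlonglongrightarrow> m * t powr (- \<alpha>)" if "t > 0" for t
  proof -
    have "(\<lambda>n. F (a n * t) / F (a n)) \<longlonglongrightarrow> t powr (- \<alpha>)"
      by (rule filterlim_compose[OF F_ratio[OF that] a_top])
    moreover have "filterlim (\<lambda>n. t * a n) at_top sequentially"
      by (rule filterlim_tendsto_pos_mult_at_top[OF tendsto_const that a_top])
    from filterlim_compose[OF P_ratio_tendsto this]
    have "(\<lambda>n. P (t * a n) / F (t * a n)) \<longlonglongrightarrow> m" .
    \<comment> \<open>A telescoping factorisation of \<open>n * P (t * a n)\<close>: the factors
      tend to 1 by the choice of \<open>a\<close>, to \<open>t powr (- \<alpha>)\<close> by regular
      variation, and to \<open>m\<close> by the tail comparison.\<close>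
    ultimately have "(\<lambda>n. (real n * F (a n)) * (F (a n * t) / F (a n)) * (P (t * a n) / F (t * a n)))
        \<longlonglongrightarrow> 1 * t powr (- \<alpha>) * m"
      by (intro tendsto_mult a)
    moreover have "(real n * F (a n)) * (F (a n * t) / F (a n)) * (P (t * a n) / F (t * a n)) =
        real n * P (t * a n)" for n
      using F_pos[of "a n"] F_pos[of "t * a n"] by (simp add: mult.commute[of "a n"])
    ultimately show ?thesis by (simp add: mult.commute)
  qed
  then show ?thesis
    using prob_space_sigma sets_sigma angular_law_weakly_converges
    by (simp add: RV_def P_def)
qed

end

theorem proposition3p4:
  fixes M :: "'a measure" and \<xi> :: "'a \<Rightarrow> real" and \<eta> Z :: "'a \<Rightarrow> real ^ 'k"
    and \<tau> :: "real ^ 'k \<Rightarrow> real" and \<alpha> :: real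
  assumes "prob_space M"
    and "indep_rvs M \<xi> \<eta>"
    and "AE \<omega> in M. \<xi> \<omega> \<ge> 0"
    and "\<alpha> > 0"
    and "regularly_varying_tail M \<xi> \<alpha>"
    and "Z = (\<lambda>\<omega>. \<xi> \<omega> *\<^sub>R \<eta> \<omega>)"
    and "\<And>x. \<tau> x \<ge> 0"
    and "continuous_on UNIV \<tau>"
    and "one_homogeneous \<tau>"
    and "integrable M (\<lambda>\<omega>. \<tau> (\<eta> \<omega>) powr \<alpha>)"
    and "(\<integral>\<omega>. \<tau> (\<eta> \<omega>) powr \<alpha> \<partial>M) > 0"
    and "(\<exists>c>0. ((\<lambda>t. t powr \<alpha> * measure M {\<omega>\<in>space M. \<xi> \<omega> > t}) \<longlongrightarrow> c) at_top) \<or>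
         (\<exists>\<delta>>0. integrable M (\<lambda>\<omega>. \<tau> (\<eta> \<omega>) powr (\<alpha> + \<delta>)))"
  shows "((\<lambda>t. measure M {\<omega>\<in>space M. \<tau> (Z \<omega>) > t} / measure M {\<omega>\<in>space M. \<xi> \<omega> > t})
            \<longlongrightarrow> (\<integral>\<omega>. \<tau> (\<eta> \<omega>) powr \<alpha> \<partial>M)) at_top \<and>
         (\<exists>\<sigma>. prob_space \<sigma> \<and> sets \<sigma> = sets (sphere_borel \<tau>) \<and>
            (\<forall>A\<in>sets (sphere_borel \<tau>). measure \<sigma> A =
               1 / (\<integral>\<omega>. \<tau> (\<eta> \<omega>) powr \<alpha> \<partial>M) *
               (\<integral>\<omega>. indicator A (\<eta> \<omega> /\<^sub>R \<tau> (\<eta> \<omega>)) * \<tau> (\<eta> \<omega>) powr \<alpha> \<partial>M)) \<and>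
            ((\<lambda>t. tv_dist (angular_law M Z \<tau> t) \<sigma>) \<longlongrightarrow> 0) at_top \<and>
            (\<forall>a. (\<lambda>n. real n * measure M {\<omega>\<in>space M. \<xi> \<omega> > a n}) \<longlonglongrightarrow> 1 \<longrightarrow>
               RV M Z \<alpha> a (\<integral>\<omega>. \<tau> (\<eta> \<omega>) powr \<alpha> \<partial>M) \<tau> \<sigma>))"
proof -
  interpret H: homogeneous_product M \<xi> \<eta> \<tau> \<alpha>
    using assms by (intro homogeneous_product.intro homogeneous_product_axioms.intro)
  have Z: "Z = H.Z" using assms(6) by (simp add: H.Z_def fun_eq_iff)
  show ?thesis
    unfolding Z H.m_def[symmetric]
  proof (intro conjI exI[of _ H.\<sigma>] ballI allI impI)
    show "((\<lambda>t. measure M {\<omega>\<in>space M. \<tau> (H.Z \<omega>) > t} / measure M {\<omega>\<in>space M. \<xi> \<omega> > t})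
        \<longlongrightarrow> H.m) at_top"
      using H.P_ratio_tendsto by (simp add: H.P_def H.F_def)
    show "RV M H.Z \<alpha> a H.m \<tau> H.\<sigma>"
      if "(\<lambda>n. real n * measure M {\<omega>\<in>space M. \<xi> \<omega> > a n}) \<longlonglongrightarrow> 1" for a
      using H.RV_Z that by (simp add: H.F_def)
  qed (fact H.prob_space_sigma H.sets_sigma H.measure_sigma H.tv_dist_tendsto)+
qed

end
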